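(* There exists a metrizable separable Baire topological group which is strongly locally homogeneous but not CDH.
   Context: The statement is asserted in ZFC. A topological space $X$ is CDH (countable dense homogeneous) if for arbitrary countable dense subsets $D_0, D_1$ of $X$ there exists a homeomorphism $\phi: X \to X$ such that $\phi[D_0]=D_1$. A space $X$ is strongly locally homogeneous if it has an open base $\mathcal{B}$ such that, for each $U\in\mathcal{B}$ and points $x,y\in U$, there exists a homeomorphism $h: X\to X$ with $h(x)=y$ and $h\upharpoonright (X\setminus U)$ equal to the identity. A topological space is Baire if the intersection of countably many dense open subsets is dense. *)

theory Defs
  imports "HOL-Analysis.Analysis" "HOL-Algebra.Group"
begin

definition dense_in :: "'a topology \<Rightarrow> 'a set \<Rightarrow> bool" where
  "dense_in T D \<longleftrightarrow> D \<subseteq> topspace T \<and> T closure_of D = topspace T"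

text \<open>\<open>countable\<close> includes the finite sets.\<close>

definition CDH_space :: "'a topology \<Rightarrow> bool" where
  "CDH_space T \<longleftrightarrow>
     (\<forall>D0 D1. countable D0 \<and> dense_in T D0 \<and> countable D1 \<and> dense_in T D1 \<longrightarrow>
        (\<exists>\<phi>. homeomorphic_map T T \<phi> \<and> \<phi> ` D0 = D1))"

definition base_of :: "'a topology \<Rightarrow> 'a set set \<Rightarrow> bool" where
  "base_of T \<B> \<longleftrightarrow>
     (\<forall>U\<in>\<B>. openin T U) \<and>
     (\<forall>W x. openin T W \<and> x \<in> W \<longrightarrow> (\<exists>U\<in>\<B>. x \<in> U \<and> U \<subseteq> W))"

definition strongly_locally_homogeneous :: "'a topology \<Rightarrow> bool" where
  "strongly_locally_homogeneous T \<longleftrightarrow>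
     (\<exists>\<B>. base_of T \<B> \<and>
        (\<forall>U\<in>\<B>. \<forall>x\<in>U. \<forall>y\<in>U.
           \<exists>h. homeomorphic_map T T h \<and> h x = y \<and> (\<forall>z\<in>topspace T - U. h z = z)))"

text \<open>Intersecting with \<open>topspace T\<close> gives the empty family the intersection \<open>topspace T\<close>
  rather than \<open>UNIV\<close>.\<close>

definition Baire_space :: "'a topology \<Rightarrow> bool" where
  "Baire_space T \<longleftrightarrow>
     (\<forall>\<U>. countable \<U> \<and> (\<forall>U\<in>\<U>. openin T U \<and> dense_in T U) \<longrightarrow>
        dense_in T (topspace T \<inter> \<Inter>\<U>))"

definition topological_group :: "'a monoid \<Rightarrow> 'a topology \<Rightarrow> bool" where
  "topological_group G T \<longleftrightarrow>
     group G \<and> topspace T = carrier G \<and>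
     continuous_map (prod_topology T T) T (\<lambda>(x, y). x \<otimes>\<^bsub>G\<^esub> y) \<and>
     continuous_map T T (\<lambda>x. inv\<^bsub>G\<^esub> x)"

text \<open>HOL cannot quantify existentially over types, so an existence claim about spaces has to
  name a type for the points. A separable metrizable space has at most continuum many points, so
  up to isomorphism every separable metrizable topological group lives on a subset of any type of
  that cardinality, such as the following one. Only the set of points is meant: the topology and
  the group structure on a subset of this type remain arbitrary.\<close>

type_synonym point = "nat \<Rightarrow> bool"

end

theory Submission
  imports Defs
begin

text \<open>The group is a dense subgroup \<open>G\<close> of the Cantor group \<open>2\<^sup>\<omega>\<close> containing all finite sequences.
  Being zero-dimensional, it is strongly locally homogeneous. To make \<open>G\<close> Baire, it is arranged to
  meet every nonempty \<open>G\<^sub>\<delta>\<close> set without isolated points. To refute CDH, let \<open>D0\<close> be the set of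
  finite sequences and \<open>D1 \<subseteq> D0\<close> a dense set no four distinct members of which sum to zero. A
  homeomorphism \<open>\<phi>\<close> of \<open>G\<close> with \<open>\<phi>[D0] = D1\<close> extends continuously to a \<open>G\<^sub>\<delta>\<close> set containing \<open>G\<close>,
  and since \<open>D0\<close> is a group, neither the extension nor its sum with the identity is constant on a
  nonempty open set. A Cantor scheme then yields a set of size continuum on which both are
  injective. As there are only continuum many bijections \<open>D0 \<rightarrow> D1\<close>, transfinite recursion can
  put into \<open>G\<close>, for each of them, a point whose image under the extension remains outside \<open>G\<close>.\<close>

section \<open>The Cantor group and the subgroups generated in it\<close>

unbundle cardinal_syntax

text \<open>Coordinatewise addition modulo 2, so every point is its own inverse.\<close>

definition padd :: "point \<Rightarrow> point \<Rightarrow> point"  (infixl "\<boxplus>" 65) where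
  "x \<boxplus> y = (\<lambda>i. x i \<noteq> y i)"

abbreviation pzero :: point  ("\<zero>\<^sub>p") where
  "\<zero>\<^sub>p \<equiv> (\<lambda>_. False)"

lemma padd_ac: "x \<boxplus> y = y \<boxplus> x" "(x \<boxplus> y) \<boxplus> z = x \<boxplus> (y \<boxplus> z)" "x \<boxplus> (y \<boxplus> z) = y \<boxplus> (x \<boxplus> z)"
  by (auto simp: padd_def)

lemma padd_simps [simp]: "x \<boxplus> x = \<zero>\<^sub>p" "x \<boxplus> \<zero>\<^sub>p = x" "\<zero>\<^sub>p \<boxplus> x = x" "x \<boxplus> (x \<boxplus> y) = y"
  "y \<boxplus> x \<boxplus> x = y"
  by (auto simp: padd_def)

lemma padd_shift: "d \<boxplus> w \<boxplus> a = d \<boxplus> b \<Longrightarrow> a = w \<boxplus> b"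
  unfolding padd_def fun_eq_iff by blast

lemma padd_eq_self: "x = x \<boxplus> y \<longleftrightarrow> y = \<zero>\<^sub>p" "y = x \<boxplus> y \<longleftrightarrow> x = \<zero>\<^sub>p"
  unfolding padd_def fun_eq_iff by blast+

lemma padd_eq_zero: "x \<boxplus> y = \<zero>\<^sub>p \<longleftrightarrow> x = y"
  unfolding padd_def fun_eq_iff by blast

lemma padd_cancel [simp]: "x \<boxplus> y = x \<boxplus> z \<longleftrightarrow> y = z"
  by (metis padd_simps(4))

text \<open>Since every point is its own inverse, repeated addition of generators already yields the
  generated subgroup.\<close>

inductive_set gen :: "point set \<Rightarrow> point set" for X where
  zero: "\<zero>\<^sub>p \<in> gen X"
| step: "x \<in> X \<Longrightarrow> y \<in> gen X \<Longrightarrow> x \<boxplus> y \<in> gen X"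

lemma gen_base: "x \<in> X \<Longrightarrow> x \<in> gen X"
  using gen.step[OF _ gen.zero] by force

lemma gen_add: "x \<in> gen X \<Longrightarrow> y \<in> gen X \<Longrightarrow> x \<boxplus> y \<in> gen X"
  by (induction rule: gen.induct) (auto simp: padd_ac(2) intro: gen.step)

lemma gen_mono:
  assumes "X \<subseteq> Y" shows "gen X \<subseteq> gen Y"
proof
  fix x assume "x \<in> gen X"
  then show "x \<in> gen Y"
    using assms by induction (auto intro: gen.intros)
qed

text \<open>Two copies of \<open>x\<close> cancel, so adjoining \<open>x\<close> adds at most the
  one coset of \<open>gen X\<close> through \<open>x\<close>.\<close>

lemma gen_insert:
  "y \<in> gen (insert x X) \<Longrightarrow> y \<in> gen X \<or> (\<exists>w\<in>gen X. y = x \<boxplus> w)"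
proof (induction rule: gen.induct)
  case (step z y)
  show ?case
  proof (cases "z = x")
    case True
    then show ?thesis using step.IH by auto
  next
    case False
    then have "z \<in> X" using step.hyps by simp
    from step.IH show ?thesis
    proof
      assume "\<exists>w\<in>gen X. y = x \<boxplus> w"
      then obtain w where w: "w \<in> gen X" "y = x \<boxplus> w" by blast
      then have "z \<boxplus> y = x \<boxplus> (z \<boxplus> w)" by (simp add: padd_ac)
      then show ?thesis using w gen.step[OF \<open>z \<in> X\<close>] by blast
    qed (use gen.step[OF \<open>z \<in> X\<close>] in blast)
  qed
qed (simp add: gen.zero)

text \<open>A sum involves finitely many of the \<open>x i\<close>. The sets \<open>L i\<close> form
  a chain, so the largest of those concerned contains all these summands; if there are none, the sum
  lies in \<open>gen Q\<close>.\<close>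

lemma gen_finitary_chain:
  assumes lin: "\<And>i j. i \<in> I \<Longrightarrow> j \<in> I \<Longrightarrow> L i \<subseteq> L j \<or> L j \<subseteq> L i"
    and self: "\<And>i. i \<in> I \<Longrightarrow> x i \<in> L i"
    and y: "y \<in> gen (Q \<union> x ` I)"
  shows "y \<in> gen Q \<or> (\<exists>i\<in>I. y \<in> gen (Q \<union> L i))"
  using y
proof (induction rule: gen.induct)
  case zero
  show ?case by (simp add: gen.zero)
next
  case (step z y)
  show ?case
  proof (cases "z \<in> Q")
    case True
    then show ?thesis using step.IH by (blast intro: gen.step)
  next
    case False
    then obtain j where j: "j \<in> I" "z = x j" using step.hyps by auto
    have zj: "z \<in> gen (Q \<union> L j)" using j self gen_base by blast
    from step.IH show ?thesis
    proof
      assume "y \<in> gen Q"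
      then have "y \<in> gen (Q \<union> L j)" using gen_mono by blast
      then show ?thesis using zj gen_add j by blast
    next
      assume "\<exists>i\<in>I. y \<in> gen (Q \<union> L i)"
      then obtain i where i: "i \<in> I" "y \<in> gen (Q \<union> L i)" by blast
      have "L i \<subseteq> L j \<or> L j \<subseteq> L i" using lin i j by blast
      then show ?thesis
      proof
        assume "L i \<subseteq> L j"
        then have "y \<in> gen (Q \<union> L j)" using i gen_mono[of "Q \<union> L i" "Q \<union> L j"] by blast
        then show ?thesis using zj gen_add j by blast
      next
        assume "L j \<subseteq> L i"
        then have "z \<in> gen (Q \<union> L i)" using zj gen_mono[of "Q \<union> L j" "Q \<union> L i"] by blast
        then show ?thesis using i gen_add by blast
      qed
    qed
  qed
qed

lemma card_of_gen:
  assumes inf: "infinite X" shows "|gen X| \<le>o |X|"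
proof -
  \<comment> \<open>\<open>S n\<close> consists of the sums of \<open>n\<close> generators,
    repetitions allowed; each \<open>S n\<close> is an image of \<open>X\<close> times its
    predecessor.\<close>
  define S where "S = rec_nat {\<zero>\<^sub>p} (\<lambda>_ S. case_prod (\<boxplus>) ` (X \<times> S))"
  have S: "S 0 = {\<zero>\<^sub>p}" "S (Suc n) = case_prod (\<boxplus>) ` (X \<times> S n)" for n
    by (auto simp: S_def)
  have card: "|S n| \<le>o |X|" for n
  proof (induction n)
    case 0
    obtain x where "x \<in> X" using inf by fastforce
    then show ?case unfolding S(1) by (intro card_of_ordLeqI[of "\<lambda>_. x"]) auto
  next
    case (Suc n)
    have "|X \<times> S n| \<le>o |X|"
      by (rule card_of_Times_ordLeq_infinite_Field[of "|X|"])
        (use inf Suc in \<open>simp_all add: Field_card_of card_of_card_order_on card_of_mono1\<close>)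
    then show ?case unfolding S(2) using card_of_image ordLeq_transitive by blast
  qed
  have "gen X \<subseteq> (\<Union>n. S n)"
  proof
    fix x assume "x \<in> gen X"
    then show "x \<in> (\<Union>n. S n)"
    proof induction
      case zero
      have "\<zero>\<^sub>p \<in> S 0" by (simp add: S)
      then show ?case by blast
    next
      case (step x y)
      then obtain n where "y \<in> S n" by blast
      then have "x \<boxplus> y \<in> S (Suc n)" using step by (force simp: S)
      then show ?case by blast
    qed
  qed
  moreover have "|\<Union>n. S n| \<le>o |X|"
    using card_of_UNION_ordLeq_infinite[OF inf, of UNIV S] card inf infinite_iff_card_of_nat by blast
  ultimately show ?thesis using card_of_mono1 ordLeq_transitive by blast
qed

section \<open>Transfinite construction of a group that given maps leave\<close>

lemma inj_on_small_preimage: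
  assumes "inj_on k P" "|V| <o |C|"
  shows "|{x\<in>P. k x \<in> V}| <o |C|"
proof -
  have "|{x\<in>P. k x \<in> V}| \<le>o |V|"
    by (rule card_of_ordLeqI[of k]) (use assms(1) in \<open>auto simp: inj_on_def\<close>)
  then show ?thesis using assms(2) ordLeq_ordLess_trans by blast
qed

text \<open>By transfinite recursion along a well-order all of whose proper initial segments have fewer
  than continuum many elements, \<open>x i \<in> A i\<close> is chosen such that \<open>x i\<close>, \<open>k i (x i)\<close> and their sum
  avoid the subgroup \<open>V\<close> generated by \<open>Q\<close> and all earlier \<open>x j\<close> and \<open>k j (x j)\<close>. Looking at the
  largest index occurring in a supposed representation of \<open>k i (x i)\<close> shows that it stays outside
  the group generated by \<open>Q\<close> and the \<open>x j\<close>.\<close>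

theorem exists_group_escaping:
  fixes A :: "point \<Rightarrow> point set" and k :: "point \<Rightarrow> point \<Rightarrow> point"
  assumes Q: "infinite Q" "|Q| <o |UNIV :: point set|"
  obtains X where "Q \<subseteq> X"
    "\<And>i P. P \<subseteq> A i \<Longrightarrow> |UNIV :: point set| \<le>o |P| \<Longrightarrow> inj_on (k i) P \<Longrightarrow>
        inj_on (\<lambda>x. x \<boxplus> k i x) P \<Longrightarrow> \<exists>x \<in> gen X \<inter> A i. k i x \<notin> gen X"
proof -
  \<comment> \<open>\<open>?r\<close> plays two roles: the cardinal of the continuum and the
    well-order on points along which the recursion runs.\<close>
  let ?r = "|UNIV :: point set|"
  define good where "good i \<longleftrightarrow> (\<exists>P. P \<subseteq> A i \<and> ?r \<le>o |P| \<and> inj_on (k i) P \<and>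
        inj_on (\<lambda>x. x \<boxplus> k i x) P)" for i
  define J where "J = {i. good i}"
  define L where "L i = underS ?r i \<inter> J" for i
  define V where "V x i = gen (Q \<union> (x ` L i \<union> (\<lambda>j. k j (x j)) ` L i))" for x i
  \<comment> \<open>At an index that is not good the requirement is void, so any value may be chosen
    there.\<close>
  define T where "T x i y \<longleftrightarrow> (good i \<longrightarrow> y \<in> A i \<and> y \<notin> V x i \<and> k i y \<notin> V x i \<and>
       y \<boxplus> k i y \<notin> V x i)" for x i y
  have wo: "well_order_on UNIV ?r" by (rule card_of_well_order_on)
  have wf: "wf (?r - Id)" using wo by (simp add: well_order_on_def)
  have tr: "trans ?r" and anti: "antisym ?r" and "refl ?r" "total ?r"
    using wo by (auto simp: well_order_on_def linear_order_on_def partial_order_on_def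
        preorder_on_def)
  then have lin: "(i,j) \<in> ?r \<or> (j,i) \<in> ?r" for i j
    unfolding total_on_def refl_on_def by (cases "i = j") auto
  have Lsub: "L i \<subseteq> L j" if "(i,j) \<in> ?r" for i j
    using that tr anti unfolding L_def underS_def trans_def antisym_def by blast
  have inf: "infinite (UNIV :: point set)" using Q by (meson finite_subset subset_UNIV)
  have Vsmall: "|V x i| <o ?r" for x i
  proof -
    have u: "|underS ?r i| <o ?r"
      by (rule card_of_underS) (auto simp: card_of_card_order_on Field_card_of)
    have "|L i| <o ?r"
      using u card_of_mono1[of "L i" "underS ?r i"] ordLeq_ordLess_trans unfolding L_def by blast
    then have "|x ` L i| <o ?r" "|(\<lambda>j. k j (x j)) ` L i| <o ?r"
      using card_of_image ordLeq_ordLess_trans by blast+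
    then have "|Q \<union> (x ` L i \<union> (\<lambda>j. k j (x j)) ` L i)| <o ?r"
      using card_of_Un_ordLess_infinite inf Q by blast
    moreover have "|V x i| \<le>o |Q \<union> (x ` L i \<union> (\<lambda>j. k j (x j)) ` L i)|"
      unfolding V_def by (rule card_of_gen) (use Q in simp)
    ultimately show ?thesis using ordLeq_ordLess_trans by blast
  qed
  have "\<exists>x. \<forall>i. T x i (x i)"
  proof (rule dependent_wf_choice[OF wf])
    fix f g :: "point \<Rightarrow> point" and i r
    assume "\<And>z. (z, i) \<in> ?r - Id \<Longrightarrow> f z = g z"
    then have "f z = g z" if "z \<in> L i" for z using that by (auto simp: L_def underS_def)
    then have "f ` L i = g ` L i" "(\<lambda>j. k j (f j)) ` L i = (\<lambda>j. k j (g j)) ` L i" by auto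
    then have "V f i = V g i" by (simp add: V_def)
    then show "T f i r = T g i r" by (simp add: T_def)
  next
    fix i and f :: "point \<Rightarrow> point"
    show "\<exists>y. T f i y"
    proof (cases "good i")
      case True
      then obtain P where P: "P \<subseteq> A i" "?r \<le>o |P|" "inj_on (k i) P" "inj_on (\<lambda>x. x \<boxplus> k i x) P"
        by (auto simp: good_def)
      let ?V = "V f i"
      \<comment> \<open>Each of the three conditions to be avoided is the preimage of the small set
        \<open>?V\<close> under a map injective on \<open>P\<close>. Together they exclude fewer
        than continuum many points of \<open>P\<close>.\<close>
      have "|{x\<in>P. id x \<in> ?V} \<union> ({x\<in>P. k i x \<in> ?V} \<union> {x\<in>P. x \<boxplus> k i x \<in> ?V})| <o ?r"
        by (intro card_of_Un_ordLess_infinite inf inj_on_small_preimage P Vsmall) simp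
      then have "\<not> P \<subseteq> {x\<in>P. id x \<in> ?V} \<union> ({x\<in>P. k i x \<in> ?V} \<union> {x\<in>P. x \<boxplus> k i x \<in> ?V})"
        using P(2) card_of_mono1 not_ordLess_ordLeq ordLeq_transitive by blast
      then show ?thesis using P(1) unfolding T_def by auto
    qed (simp add: T_def)
  qed
  then obtain x where x: "\<And>i. T x i (x i)" by blast
  \<comment> \<open>Unlike \<open>V x i\<close>, this subgroup omits the values of \<open>k\<close>:
    it is the part of the final group built before stage \<open>i\<close>.\<close>
  define M where "M i = gen (Q \<union> x ` L i)" for i
  have MV: "M i \<subseteq> V x i" for i unfolding M_def V_def by (rule gen_mono) blast
  have QV: "gen Q \<subseteq> V x i" for i unfolding V_def by (rule gen_mono) blast
  have in_V: "x j \<in> V x i" "k j (x j) \<in> V x i" if "(j,i) \<in> ?r" "j \<noteq> i" "good j" for i j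
    using that unfolding V_def by (auto intro!: gen_base simp: L_def underS_def J_def)
  have V_mono: "V x i \<subseteq> V x j" if "(i,j) \<in> ?r" for i j
    unfolding V_def by (rule gen_mono) (use Lsub[OF that] in blast)
  have V_add: "a \<in> V x i \<Longrightarrow> b \<in> V x i \<Longrightarrow> a \<boxplus> b \<in> V x i" for a b i
    unfolding V_def by (rule gen_add)
  have good_iff: "good i \<longleftrightarrow> i \<in> J" for i by (simp add: J_def)
  have chain: "y \<in> gen Q \<or> (\<exists>i\<in>I. y \<in> M i \<or> (\<exists>w\<in>M i. y = x i \<boxplus> w))"
    if "I \<subseteq> J" "y \<in> gen (Q \<union> x ` I)" for I y
  proof -
    \<comment> \<open>Including \<open>i\<close> itself in the initial segment makes
      \<open>i\<close> the largest index used; \<open>gen_insert\<close> then splits off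
      \<open>x i\<close>.\<close>
    have "y \<in> gen Q \<or> (\<exists>i\<in>I. y \<in> gen (Q \<union> x ` insert i (L i)))"
    proof (rule gen_finitary_chain[OF _ _ that(2)])
      fix i j assume ij: "i \<in> I" "j \<in> I"
      have *: "insert i (L i) \<subseteq> insert j (L j)" if "(i,j) \<in> ?r" "i \<in> I" for i j
        using Lsub[OF that(1)] that \<open>I \<subseteq> J\<close> by (auto simp: L_def underS_def)
      show "x ` insert i (L i) \<subseteq> x ` insert j (L j) \<or> x ` insert j (L j) \<subseteq> x ` insert i (L i)"
        using *[of i j] *[of j i] lin[of i j] ij by (meson image_mono)
    qed simp
    then show ?thesis
    proof
      assume "\<exists>i\<in>I. y \<in> gen (Q \<union> x ` insert i (L i))"
      then obtain i where i: "i \<in> I" "y \<in> gen (insert (x i) (Q \<union> x ` L i))" by auto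
      then show ?thesis using gen_insert[OF i(2)] by (auto simp: M_def)
    qed blast
  qed
  \<comment> \<open>The index \<open>a\<close> is fixed and the induction runs over the largest
    index \<open>i\<close> that a representation of \<open>k a (x a)\<close> may use.\<close>
  have notM: "k a (x a) \<notin> M i \<and> (good i \<longrightarrow> (\<forall>w\<in>M i. k a (x a) \<noteq> x i \<boxplus> w))" if a: "good a" for a i
    using wf
  proof (induction i rule: wf_induct_rule)
    case (less i)
    have Ta: "k a (x a) \<notin> V x a" "x a \<boxplus> k a (x a) \<notin> V x a" using x[of a] a by (auto simp: T_def)
    have M: "k a (x a) \<notin> M i"
    proof
      assume *: "k a (x a) \<in> M i"
      have "L i \<subseteq> J" by (auto simp: L_def)
      from chain[OF this *[unfolded M_def]] Ta QV obtain j where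
        j: "j \<in> L i" "k a (x a) \<in> M j \<or> (\<exists>w\<in>M j. k a (x a) = x j \<boxplus> w)" by blast
      then have "(j, i) \<in> ?r - Id" "good j" by (auto simp: L_def underS_def J_def)
      then show False using less.IH j by blast
    qed
    moreover have False if w: "good i" "w \<in> M i" "k a (x a) = x i \<boxplus> w" for w
    proof -
      have wV: "w \<in> V x i" using w MV by blast
      have xi: "x i \<notin> V x i" using x[of i] w by (auto simp: T_def)
      \<comment> \<open>For \<open>i = a\<close> the sum of \<open>x a\<close> and
        \<open>k a (x a)\<close> would lie in \<open>V x a\<close>; for \<open>i\<close> before
        \<open>a\<close> so would \<open>k a (x a)\<close>; for \<open>a\<close> before
        \<open>i\<close> the point \<open>x i\<close> would lie in \<open>V x i\<close>. The choice
        of \<open>x\<close> excludes all three.\<close>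
      consider "i = a" | "(i,a) \<in> ?r" "i \<noteq> a" | "(a,i) \<in> ?r" "a \<noteq> i" using lin by blast
      then show False
      proof cases
        case 1
        then show False using w wV Ta by simp
      next
        case 2
        then have "w \<in> V x a" "x i \<in> V x a" using wV V_mono in_V w by blast+
        then show False using V_add w Ta by metis
      next
        case 3
        then have "k a (x a) \<boxplus> w \<in> V x i" using in_V a wV V_add by blast
        moreover have "k a (x a) \<boxplus> w = x i" using w by (simp add: padd_ac)
        ultimately show False using xi by simp
      qed
    qed
    ultimately show ?case by blast
  qed
  show thesis
  proof (rule that)
    show "Q \<subseteq> Q \<union> x ` J" by blast
    fix i P assume "P \<subseteq> A i" "?r \<le>o |P|" "inj_on (k i) P" "inj_on (\<lambda>x. x \<boxplus> k i x) P"
    then have i: "good i" by (auto simp: good_def)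
    have "k i (x i) \<notin> gen (Q \<union> x ` J)"
    proof
      assume "k i (x i) \<in> gen (Q \<union> x ` J)"
      moreover have "k i (x i) \<notin> gen Q" using QV x[of i] i by (auto simp: T_def)
      ultimately show False using chain[of J "k i (x i)"] notM[OF i] good_iff by blast
    qed
    moreover have "x i \<in> gen (Q \<union> x ` J)" using i by (auto intro!: gen_base simp: J_def)
    moreover have "x i \<in> A i" using x[of i] i by (auto simp: T_def)
    ultimately show "\<exists>y \<in> gen (Q \<union> x ` J) \<inter> A i. k i y \<notin> gen (Q \<union> x ` J)" by blast
  qed
qed

subsection \<open>Cantor schemes\<close>

text \<open>Openness and continuity are phrased through cylinders to keep the combinatorics
  elementary; \<open>openin_cantor\<close> and \<open>continuous_map_sub_top\<close> connect them
  with the topologies.\<close>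

definition cyl :: "point \<Rightarrow> nat \<Rightarrow> point set" where
  "cyl x n = {y. \<forall>i<n. y i = x i}"

definition cyl_open :: "point set \<Rightarrow> bool" where
  "cyl_open U \<longleftrightarrow> (\<forall>x\<in>U. \<exists>m. cyl x m \<subseteq> U)"

definition cyl_cont :: "point set \<Rightarrow> (point \<Rightarrow> point) \<Rightarrow> bool" where
  "cyl_cont A k \<longleftrightarrow> (\<forall>x\<in>A. \<forall>n. \<exists>m. \<forall>y \<in> A \<inter> cyl x m. k y \<in> cyl (k x) n)"

definition nowhere_const :: "point set \<Rightarrow> (point \<Rightarrow> point) \<Rightarrow> bool" where
  "nowhere_const A k \<longleftrightarrow> (\<forall>x\<in>A. \<forall>n. \<exists>y \<in> A \<inter> cyl x n. k y \<noteq> k x)"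

lemma cyl_self [simp]: "x \<in> cyl x n"
  by (simp add: cyl_def)

lemma cyl_mono: "m \<le> n \<Longrightarrow> cyl x n \<subseteq> cyl x m"
  by (auto simp: cyl_def)

lemma cyl_cong: "y \<in> cyl x n \<Longrightarrow> cyl y n = cyl x n"
  by (auto simp: cyl_def)

lemma cyl_sub: "y \<in> cyl x m \<Longrightarrow> m \<le> n \<Longrightarrow> cyl y n \<subseteq> cyl x m"
  using cyl_cong cyl_mono by blast

lemma cyl_nonempty [simp]: "cyl x n \<noteq> {}"
  using cyl_self by blast

lemma neq_imp_cyl_disjoint:
  assumes "x \<noteq> y" obtains n where "cyl x n \<inter> cyl y n = {}"
proof -
  obtain i where "x i \<noteq> y i" using assms by blast
  then have "cyl x (Suc i) \<inter> cyl y (Suc i) = {}" by (force simp: cyl_def)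
  then show thesis using that by blast
qed

lemma cyl_cont_padd:
  assumes "cyl_cont A k" shows "cyl_cont A (\<lambda>x. x \<boxplus> k x)"
  unfolding cyl_cont_def
proof (intro ballI allI)
  fix x n assume "x \<in> A"
  then obtain m where m: "\<And>y. y \<in> A \<inter> cyl x m \<Longrightarrow> k y \<in> cyl (k x) n"
    using assms unfolding cyl_cont_def by blast
  have "y \<boxplus> k y \<in> cyl (x \<boxplus> k x) n" if "y \<in> A \<inter> cyl x (max m n)" for y
    using m[of y] that by (auto simp: cyl_def padd_def)
  then show "\<exists>m. \<forall>y \<in> A \<inter> cyl x m. y \<boxplus> k y \<in> cyl (x \<boxplus> k x) n" by blast
qed

text \<open>Disjoint cylinders around the two values are pulled back by continuity. Allowing every
  \<open>m'\<close> above \<open>m\<close> lets several such conditions be met at once by a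
  maximum.\<close>

lemma cyl_cont_separate:
  assumes "cyl_cont A k" "a \<in> A" "b \<in> A" "k a \<noteq> k b"
  obtains m where "\<And>m' u v. m \<le> m' \<Longrightarrow> u \<in> A \<inter> cyl a m' \<Longrightarrow> v \<in> A \<inter> cyl b m' \<Longrightarrow> k u \<noteq> k v"
proof -
  obtain n where n: "cyl (k a) n \<inter> cyl (k b) n = {}"
    using assms(4) neq_imp_cyl_disjoint by blast
  obtain m1 where "\<forall>y \<in> A \<inter> cyl a m1. k y \<in> cyl (k a) n"
    using assms unfolding cyl_cont_def by blast
  moreover obtain m2 where "\<forall>y \<in> A \<inter> cyl b m2. k y \<in> cyl (k b) n"
    using assms unfolding cyl_cont_def by blast
  ultimately have "k u \<noteq> k v" if "max m1 m2 \<le> m'" "u \<in> A \<inter> cyl a m'" "v \<in> A \<inter> cyl b m'" for m' u v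
    using n that cyl_mono[of m1 m' a] cyl_mono[of m2 m' b]
    by (metis IntD1 IntD2 IntI empty_iff max.bounded_iff subsetD)
  then show thesis using that by blast
qed

text \<open>First \<open>k\<close> is made to change. If \<open>l\<close> has not changed yet, a
  further move changes it, so small that the values of \<open>k\<close> stay apart.\<close>

lemma common_split:
  assumes k: "cyl_cont A k" "nowhere_const A k" and l: "nowhere_const A l" and a: "a \<in> A"
  obtains b where "b \<in> A \<inter> cyl a n" "k b \<noteq> k a" "l b \<noteq> l a"
proof -
  obtain b where b: "b \<in> A \<inter> cyl a n" "k b \<noteq> k a"
    using k(2) a unfolding nowhere_const_def by blast
  show thesis
  proof (cases "l b = l a")
    case True
    obtain m where m: "\<And>m' u v. m \<le> m' \<Longrightarrow> u \<in> A \<inter> cyl a m' \<Longrightarrow> v \<in> A \<inter> cyl b m' \<Longrightarrow> k u \<noteq> k v"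
      using cyl_cont_separate[OF k(1) a, of b] b by (metis IntD1)
    obtain c where c: "c \<in> A \<inter> cyl b (max m n)" "l c \<noteq> l b"
      using l b unfolding nowhere_const_def by blast
    have "k c \<noteq> k a" using m[of "max m n" a c] c a by auto
    moreover have "c \<in> A \<inter> cyl a n"
      using c b cyl_sub[of b a n "max m n"] by auto
    ultimately show thesis using that c True by auto
  qed (use b that in blast)
qed

text \<open>A binary tree of shrinking cylinders with centres in \<open>A\<close> is built. Siblings
  have distinct values under both maps, and level \<open>j\<close> enters \<open>U j\<close>, so
  each branch converges to a point of \<open>A\<close>.\<close>

theorem cantor_scheme:
  fixes U :: "nat \<Rightarrow> point set"
  assumes op: "\<And>n. cyl_open (U n)" and A: "A = (\<Inter>n. U n)" and ne: "A \<noteq> {}"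
    and k: "cyl_cont A k" "nowhere_const A k" and l: "cyl_cont A l" "nowhere_const A l"
  obtains g :: "point \<Rightarrow> point" where "range g \<subseteq> A" "inj (\<lambda>x. k (g x))" "inj (\<lambda>x. l (g x))"
proof -
  \<comment> \<open>The node with centre \<open>a\<close> and length \<open>m\<close> gets two
    children of common length \<open>m'\<close>, centred at \<open>a\<close> and at
    \<open>c\<close>.\<close>
  define Q where "Q j a m c m' \<longleftrightarrow> c \<in> A \<inter> cyl a m \<and> m < m' \<and> cyl a m' \<subseteq> U j \<and> cyl c m' \<subseteq> U j \<and>
    (\<forall>u \<in> A \<inter> cyl a m'. \<forall>v \<in> A \<inter> cyl c m'. k u \<noteq> k v \<and> l u \<noteq> l v)" for j a m c m'
  have ex: "\<exists>c m'. Q j a m c m'" if a: "a \<in> A" for j a m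
  proof -
    obtain c where c: "c \<in> A \<inter> cyl a m" "k c \<noteq> k a" "l c \<noteq> l a"
      using common_split[OF k l(2) a] by blast
    then have cA: "c \<in> A" by blast
    obtain m1 where m1: "\<And>m' u v. m1 \<le> m' \<Longrightarrow> u \<in> A \<inter> cyl a m' \<Longrightarrow> v \<in> A \<inter> cyl c m' \<Longrightarrow> k u \<noteq> k v"
      using cyl_cont_separate[OF k(1) a cA c(2)[symmetric]] by blast
    obtain m2 where m2: "\<And>m' u v. m2 \<le> m' \<Longrightarrow> u \<in> A \<inter> cyl a m' \<Longrightarrow> v \<in> A \<inter> cyl c m' \<Longrightarrow> l u \<noteq> l v"
      using cyl_cont_separate[OF l(1) a cA c(3)[symmetric]] by blast
    have "a \<in> U j" "c \<in> U j" using a cA A by auto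
    then obtain m3 m4 where m34: "cyl a m3 \<subseteq> U j" "cyl c m4 \<subseteq> U j"
      using op unfolding cyl_open_def by meson
    define m' where "m' = Max {m1, m2, m3, m4, Suc m}"
    have le: "m1 \<le> m'" "m2 \<le> m'" "m3 \<le> m'" "m4 \<le> m'" "m < m'" by (auto simp: m'_def)
    have "Q j a m c m'"
      unfolding Q_def
    proof (intro conjI ballI)
      show "cyl a m' \<subseteq> U j" "cyl c m' \<subseteq> U j" using m34 cyl_mono le by blast+
    qed (use c le m1 m2 in auto)
    then show ?thesis by blast
  qed
  define C where "C j a m = (SOME c. \<exists>m'. Q j a m c m')" for j a m
  define M where "M j a m = (SOME m'. Q j a m (C j a m) m')" for j a m
  have CM: "Q j a m (C j a m) (M j a m)" if "a \<in> A" for j a m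
  proof -
    have "\<exists>m'. Q j a m (C j a m) m'"
      using someI_ex[OF ex[OF that]] unfolding C_def .
    then show ?thesis unfolding M_def by (rule someI_ex)
  qed
  obtain a0 where a0: "a0 \<in> A" using ne by blast
  define node :: "point \<Rightarrow> nat \<Rightarrow> point \<times> nat" where
    "node x = rec_nat (a0, 0)
       (\<lambda>j (a, m). (if x j then C j a m else a, M j a m))" for x
  define P where "P x j = fst (node x j)" for x j
  define N where "N x j = snd (node x j)" for x j
  have P0: "P x 0 = a0" "N x 0 = 0" for x by (simp_all add: P_def N_def node_def)
  have PS: "P x (Suc j) = (if x j then C j (P x j) (N x j) else P x j)"
    "N x (Suc j) = M j (P x j) (N x j)" for x j
    by (simp_all add: P_def N_def node_def case_prod_beta)
  have PA: "P x j \<in> A" for x j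
    by (induction j) (use CM a0 in \<open>auto simp: P0 PS Q_def\<close>)
  have step: "Q j (P x j) (N x j) (C j (P x j) (N x j)) (N x (Suc j))" for x j
    using CM[OF PA] by (simp add: PS)
  have N_less: "N x j < N x (Suc j)" for x j using step by (auto simp: Q_def)
  have N_ge: "j \<le> N x j" for x j
    by (induction j) (use N_less in \<open>auto intro: le_less_trans simp: Suc_le_eq\<close>)
  have nest: "cyl (P x (Suc j)) (N x (Suc j)) \<subseteq> cyl (P x j) (N x j)" for x j
  proof -
    have "P x (Suc j) \<in> cyl (P x j) (N x j)" using step[of j x] by (auto simp: PS Q_def)
    then show ?thesis using N_less[of x j] by (intro cyl_sub) auto
  qed
  have nested: "cyl (P x j') (N x j') \<subseteq> cyl (P x j) (N x j)" if "j \<le> j'" for x j j'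
    using that by (rule lift_Suc_antimono_le[of "\<lambda>j. cyl (P x j) (N x j)", OF nest])
  \<comment> \<open>Coordinate \<open>i\<close> is settled from level \<open>Suc i\<close> on,
    because the cylinder there has length at least \<open>Suc i\<close>.\<close>
  define g where "g x i = P x (Suc i) i" for x i
  have gcyl: "g x \<in> cyl (P x j) (N x j)" for x j
    unfolding cyl_def
  proof (intro CollectI allI impI)
    fix i assume i: "i < N x j"
    show "g x i = P x j i"
    proof (cases "j \<le> Suc i")
      case True
      then have "P x (Suc i) \<in> cyl (P x j) (N x j)" using nested cyl_self by blast
      then show ?thesis using i by (simp add: g_def cyl_def)
    next
      case False
      then have "P x j \<in> cyl (P x (Suc i)) (N x (Suc i))" using nested[of "Suc i" j] cyl_self
        by (meson nat_le_linear subsetD)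
      then show ?thesis using N_ge[of "Suc i" x] by (simp add: g_def cyl_def)
    qed
  qed
  have gA: "g x \<in> A" for x
  proof -
    \<comment> \<open>Membership in \<open>U j\<close> is secured one level later, for both children
      of the node at level \<open>j\<close>.\<close>
    have "g x \<in> U j" for j
      using gcyl[of x "Suc j"] step[of j x] by (auto simp: PS Q_def split: if_splits)
    then show ?thesis by (simp add: A)
  qed
  \<comment> \<open>The two branches share the node at level \<open>j\<close> and then pass to
    different children.\<close>
  have sep: "k (g x) \<noteq> k (g y) \<and> l (g x) \<noteq> l (g y)" if j: "\<And>i. i < j \<Longrightarrow> x i = y i" "\<not> x j" "y j" for x y j
  proof -
    have "node x i = node y i" if "i \<le> j" for i
      using that by (induction i) (auto simp: node_def j split: prod.splits)
    then have eq: "P x j = P y j" "N x j = N y j" by (auto simp: P_def N_def)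
    have "N x (Suc j) = N y (Suc j)" "P x (Suc j) = P x j"
      "P y (Suc j) = C j (P x j) (N x j)" using eq j by (simp_all add: PS)
    then have "g x \<in> A \<inter> cyl (P x j) (N x (Suc j))"
      "g y \<in> A \<inter> cyl (C j (P x j) (N x j)) (N x (Suc j))"
      using gA gcyl by (metis IntI)+
    then show ?thesis using step[of j x] unfolding Q_def by blast
  qed
  have neq: "k (g x) \<noteq> k (g y) \<and> l (g x) \<noteq> l (g y)" if "x \<noteq> y" for x y
  proof -
    define j where "j = (LEAST i. x i \<noteq> y i)"
    have "x j \<noteq> y j" unfolding j_def by (rule LeastI_ex) (use that in blast)
    moreover have "x i = y i" if "i < j" for i
      using not_less_Least that unfolding j_def by blast
    ultimately show ?thesis using sep[of j x y] sep[of j y x] by (metis (full_types))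
  qed
  show thesis
    by (rule that[of g]) (use gA neq in \<open>auto simp: inj_on_def\<close>)
qed

text \<open>The scheme is applied with \<open>l\<close> the sum of \<open>k\<close> and the
  identity. Injectivity of \<open>k\<close> after \<open>g\<close> forces that of \<open>g\<close>,
  so the range of \<open>g\<close> has the size of the continuum.\<close>

corollary perfect_subset:
  fixes U :: "nat \<Rightarrow> point set"
  assumes "\<And>n. cyl_open (U n)" "A = (\<Inter>n. U n)" "A \<noteq> {}"
    "cyl_cont A k" "nowhere_const A k" "nowhere_const A (\<lambda>x. x \<boxplus> k x)"
  obtains P where "P \<subseteq> A" "|UNIV :: point set| \<le>o |P|" "inj_on k P" "inj_on (\<lambda>x. x \<boxplus> k x) P"
proof -
  obtain g :: "point \<Rightarrow> point" where g: "range g \<subseteq> A" "inj (\<lambda>x. k (g x))" "inj (\<lambda>x. g x \<boxplus> k (g x))"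
    by (rule cantor_scheme[OF assms(1-5) cyl_cont_padd[OF assms(4)] assms(6)])
  have "inj g" using inj_on_imageI2[of k g UNIV] g(2) by (simp add: comp_def)
  then have "|UNIV :: point set| \<le>o |range g|" by (intro card_of_ordLeqI[of g]) auto
  moreover have "inj_on k (range g)" "inj_on (\<lambda>x. x \<boxplus> k x) (range g)"
    using g(2,3) by (auto intro!: inj_on_imageI simp: comp_def)
  ultimately show thesis using that[of "range g"] g(1) by simp
qed

subsection \<open>Subgroups of the Cantor group\<close>

definition cantor_topology :: "point topology" where
  "cantor_topology = product_topology (\<lambda>_. discrete_topology UNIV) UNIV"

lemma topspace_cantor [simp]: "topspace cantor_topology = UNIV"
  by (simp add: cantor_topology_def)

lemma openin_cantor: "openin cantor_topology U \<longleftrightarrow> cyl_open U"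
  unfolding cantor_topology_def openin_product_topology_alt cyl_open_def
proof (intro ball_cong refl iffI)
  fix x
  assume "\<exists>V. finite {i \<in> UNIV. V i \<noteq> topspace (discrete_topology (UNIV :: bool set))} \<and>
      (\<forall>i\<in>UNIV. openin (discrete_topology UNIV) (V i)) \<and> x \<in> Pi\<^sub>E UNIV V \<and> Pi\<^sub>E UNIV V \<subseteq> U"
  then obtain V where V: "finite {i. V i \<noteq> UNIV}" "x \<in> Pi\<^sub>E UNIV V" "Pi\<^sub>E UNIV V \<subseteq> U" by auto
  \<comment> \<open>A basic open set of the product restricts finitely many coordinates, all below
    some \<open>m\<close>.\<close>
  obtain m where m: "\<forall>i\<in>{i. V i \<noteq> UNIV}. i < m"
    using V(1) finite_nat_set_iff_bounded by blast
  have "cyl x m \<subseteq> Pi\<^sub>E UNIV V"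
  proof
    fix y assume y: "y \<in> cyl x m"
    have "y i \<in> V i" for i
      using m V(2) y by (cases "V i = UNIV") (auto simp: cyl_def PiE_iff)
    then show "y \<in> Pi\<^sub>E UNIV V" by (auto simp: PiE_iff)
  qed
  then show "\<exists>m. cyl x m \<subseteq> U" using V by blast
next
  fix x assume "\<exists>m. cyl x m \<subseteq> U"
  then obtain m where m: "cyl x m \<subseteq> U" by blast
  define V where "V i = (if i < m then {x i} else UNIV)" for i
  have "finite {i. V i \<noteq> UNIV}"
    by (rule finite_subset[of _ "{..<m}"]) (auto simp: V_def)
  moreover have "x \<in> Pi\<^sub>E UNIV V" by (auto simp: PiE_iff V_def)
  moreover have "Pi\<^sub>E UNIV V \<subseteq> cyl x m"
  proof
    fix y assume "y \<in> Pi\<^sub>E UNIV V"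
    then have "y i \<in> V i" for i by (simp add: PiE_iff)
    then have "y i = x i" if "i < m" for i using that by (metis V_def singletonD)
    then show "y \<in> cyl x m" by (simp add: cyl_def)
  qed
  ultimately show "\<exists>V. finite {i \<in> UNIV. V i \<noteq> topspace (discrete_topology (UNIV :: bool set))} \<and>
      (\<forall>i\<in>UNIV. openin (discrete_topology UNIV) (V i)) \<and> x \<in> Pi\<^sub>E UNIV V \<and> Pi\<^sub>E UNIV V \<subseteq> U"
    using m by (intro exI[of _ V]) auto
qed

lemma cyl_open_cyl: "cyl_open (cyl x n)"
  unfolding cyl_open_def using cyl_cong by blast

lemma cyl_open_Int: "cyl_open U \<Longrightarrow> cyl_open V \<Longrightarrow> cyl_open (U \<inter> V)"
  using openin_Int by (simp flip: openin_cantor)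

lemma completely_metrizable_cantor: "completely_metrizable_space cantor_topology"
  unfolding cantor_topology_def completely_metrizable_space_product_topology
  by (simp add: completely_metrizable_space_discrete_topology)

text \<open>The Baire category theorem for a completely metrizable space, in cylinder form.\<close>

lemma cantor_Baire:
  assumes "countable \<U>" and op: "\<And>U. U \<in> \<U> \<Longrightarrow> cyl_open U"
    and dense: "\<And>U x n. U \<in> \<U> \<Longrightarrow> U \<inter> cyl x n \<noteq> {}"
  shows "\<exists>y \<in> cyl x n. \<forall>U\<in>\<U>. y \<in> U"
proof -
  have "cantor_topology closure_of \<Inter>\<U> = topspace cantor_topology"
  proof (rule Baire_category)
    fix U assume U: "U \<in> \<U>"
    have "cantor_topology closure_of U = topspace cantor_topology"
      unfolding dense_intersects_open
    proof (intro allI impI)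
      fix V assume "openin cantor_topology V \<and> V \<noteq> {}"
      then obtain x n where "cyl x n \<subseteq> V" unfolding openin_cantor cyl_open_def by blast
      then show "U \<inter> V \<noteq> {}" using dense[OF U, of x n] by blast
    qed
    then show "openin cantor_topology U \<and> cantor_topology closure_of U = topspace cantor_topology"
      using op[OF U] by (simp add: openin_cantor)
  qed (use assms(1) completely_metrizable_cantor in auto)
  then have "\<Inter>\<U> \<inter> cyl x n \<noteq> {}"
    unfolding dense_intersects_open using cyl_open_cyl cyl_self by (metis empty_iff openin_cantor)
  then show ?thesis by blast
qed

abbreviation sub_top :: "point set \<Rightarrow> point topology" where
  "sub_top G \<equiv> subtopology cantor_topology G"

lemma openin_sub_top:
  "openin (sub_top G) W \<longleftrightarrow> W \<subseteq> G \<and> (\<forall>x\<in>W. \<exists>m. G \<inter> cyl x m \<subseteq> W)"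
proof
  assume "openin (sub_top G) W"
  then obtain V where "cyl_open V" "W = V \<inter> G" by (auto simp: openin_subtopology openin_cantor)
  then show "W \<subseteq> G \<and> (\<forall>x\<in>W. \<exists>m. G \<inter> cyl x m \<subseteq> W)" unfolding cyl_open_def by blast
next
  assume W: "W \<subseteq> G \<and> (\<forall>x\<in>W. \<exists>m. G \<inter> cyl x m \<subseteq> W)"
  define V where "V = \<Union>{cyl x m | x m. G \<inter> cyl x m \<subseteq> W}"
  have "openin cantor_topology V"
    unfolding V_def by (rule openin_Union) (auto simp: openin_cantor cyl_open_cyl)
  moreover have "W = V \<inter> G"
  proof
    show "W \<subseteq> V \<inter> G" unfolding V_def using W cyl_self by blast
    show "V \<inter> G \<subseteq> W" unfolding V_def by blast
  qed
  ultimately show "openin (sub_top G) W" by (auto simp: openin_subtopology)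
qed

lemma openin_sub_top_cyl: "openin (sub_top G) (G \<inter> cyl x n)"
  unfolding openin_sub_top using cyl_cong by blast

lemma dense_in_sub_top:
  "dense_in (sub_top G) D \<longleftrightarrow> D \<subseteq> G \<and> (\<forall>x\<in>G. \<forall>n. D \<inter> cyl x n \<noteq> {})"
proof -
  have "(sub_top G) closure_of D = G \<longleftrightarrow> (\<forall>x\<in>G. \<forall>n. D \<inter> cyl x n \<noteq> {})" if "D \<subseteq> G"
  proof -
    have "(sub_top G) closure_of D = topspace (sub_top G) \<longleftrightarrow> (\<forall>x\<in>G. \<forall>n. D \<inter> cyl x n \<noteq> {})"
      unfolding dense_intersects_open
    proof (intro iffI ballI allI impI)
      fix x n assume "\<forall>T. openin (sub_top G) T \<and> T \<noteq> {} \<longrightarrow> D \<inter> T \<noteq> {}" "x \<in> G"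
      moreover have "G \<inter> cyl x n \<noteq> {}" using \<open>x \<in> G\<close> cyl_self by blast
      ultimately show "D \<inter> cyl x n \<noteq> {}" using openin_sub_top_cyl by blast
    next
      fix V assume D: "\<forall>x\<in>G. \<forall>n. D \<inter> cyl x n \<noteq> {}" and V: "openin (sub_top G) V \<and> V \<noteq> {}"
      then obtain x m where "x \<in> G" "G \<inter> cyl x m \<subseteq> V" unfolding openin_sub_top by blast
      then show "D \<inter> V \<noteq> {}" using D that by blast
    qed
    then show ?thesis by simp
  qed
  then show ?thesis by (auto simp: dense_in_def)
qed

lemma continuous_map_sub_top:
  "continuous_map (sub_top G) (sub_top G) h \<longleftrightarrow> h ` G \<subseteq> G \<and> cyl_cont G h"
proof
  assume h: "continuous_map (sub_top G) (sub_top G) h"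
  then have im: "h ` G \<subseteq> G" by (auto simp: continuous_map_def)
  have "\<exists>m. \<forall>y \<in> G \<inter> cyl x m. h y \<in> cyl (h x) n" if x: "x \<in> G" for x n
  proof -
    have "openin (sub_top G) {y \<in> topspace (sub_top G). h y \<in> G \<inter> cyl (h x) n}"
      using h openin_sub_top_cyl unfolding continuous_map_def by blast
    then show ?thesis using x im unfolding openin_sub_top by fastforce
  qed
  then show "h ` G \<subseteq> G \<and> cyl_cont G h" using im by (simp add: cyl_cont_def)
next
  assume h: "h ` G \<subseteq> G \<and> cyl_cont G h"
  show "continuous_map (sub_top G) (sub_top G) h"
    unfolding continuous_map_def
  proof (intro conjI allI impI)
    fix V assume V: "openin (sub_top G) V"
    show "openin (sub_top G) {x \<in> topspace (sub_top G). h x \<in> V}"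
      unfolding openin_sub_top
    proof (intro conjI ballI)
      fix x assume "x \<in> {x \<in> topspace (sub_top G). h x \<in> V}"
      then have x: "x \<in> G" "h x \<in> V" by auto
      then obtain n where n: "G \<inter> cyl (h x) n \<subseteq> V" using V unfolding openin_sub_top by blast
      obtain m where "\<forall>y \<in> G \<inter> cyl x m. h y \<in> cyl (h x) n"
        using h x unfolding cyl_cont_def by blast
      then have "G \<inter> cyl x m \<subseteq> {x \<in> topspace (sub_top G). h x \<in> V}" using n h by auto
      then show "\<exists>m. G \<inter> cyl x m \<subseteq> {x \<in> topspace (sub_top G). h x \<in> V}" by blast
    qed auto
  qed (use h in auto)
qed

definition cantor_subgroup :: "point set \<Rightarrow> bool" where
  "cantor_subgroup G \<longleftrightarrow> \<zero>\<^sub>p \<in> G \<and> (\<forall>x\<in>G. \<forall>y\<in>G. x \<boxplus> y \<in> G)"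

text \<open>The first \<open>n\<close> coordinates of a sum depend only on those of the summands,
  and inversion is the identity.\<close>

lemma topological_group_sub_top:
  assumes "cantor_subgroup G"
  shows "topological_group \<lparr>carrier = G, monoid.mult = (\<boxplus>), one = \<zero>\<^sub>p\<rparr> (sub_top G)"
    (is "topological_group ?G _")
proof -
  have zero: "\<zero>\<^sub>p \<in> G" and add: "x \<boxplus> y \<in> G" if "x \<in> G" "y \<in> G" for x y
    using assms that by (auto simp: cantor_subgroup_def)
  have grp: "group ?G"
  proof (rule groupI)
    fix x assume "x \<in> carrier ?G"
    then show "\<exists>y\<in>carrier ?G. y \<otimes>\<^bsub>?G\<^esub> x = \<one>\<^bsub>?G\<^esub>" by (auto intro!: bexI[of _ x])
  qed (use assms in \<open>auto simp: cantor_subgroup_def padd_ac\<close>)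
  have inv: "inv\<^bsub>?G\<^esub> x = x" if "x \<in> G" for x
    using group.inv_equality[OF grp, of x x] that by simp
  have "continuous_map (prod_topology (sub_top G) (sub_top G)) (sub_top G) (\<lambda>(x, y). x \<boxplus> y)"
    unfolding continuous_map_def
  proof (intro conjI allI impI)
    fix V assume V: "openin (sub_top G) V"
    show "openin (prod_topology (sub_top G) (sub_top G))
       {p \<in> topspace (prod_topology (sub_top G) (sub_top G)). (case p of (x, y) \<Rightarrow> x \<boxplus> y) \<in> V}"
      unfolding openin_prod_topology_alt
    proof (intro allI impI)
      fix x y
      assume "(x, y) \<in> {p \<in> topspace (prod_topology (sub_top G) (sub_top G)).
                (case p of (x, y) \<Rightarrow> x \<boxplus> y) \<in> V}"
      then have xy: "x \<in> G" "y \<in> G" "x \<boxplus> y \<in> V" by auto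
      then obtain n where n: "G \<inter> cyl (x \<boxplus> y) n \<subseteq> V" using V unfolding openin_sub_top by blast
      have "u \<boxplus> v \<in> V" if "u \<in> G \<inter> cyl x n" "v \<in> G \<inter> cyl y n" for u v
      proof -
        have "u \<boxplus> v \<in> cyl (x \<boxplus> y) n" using that by (auto simp: cyl_def padd_def)
        then show ?thesis using n add that by blast
      qed
      then show "\<exists>U W. openin (sub_top G) U \<and> openin (sub_top G) W \<and> x \<in> U \<and> y \<in> W \<and>
          U \<times> W \<subseteq> {p \<in> topspace (prod_topology (sub_top G) (sub_top G)).
                (case p of (x, y) \<Rightarrow> x \<boxplus> y) \<in> V}"
        using xy by (intro exI[of _ "G \<inter> cyl x n"] exI[of _ "G \<inter> cyl y n"])
          (auto simp: openin_sub_top_cyl)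
    qed
  qed (use add in auto)
  moreover have "continuous_map (sub_top G) (sub_top G) (\<lambda>x. inv\<^bsub>?G\<^esub> x)"
    by (rule continuous_map_eq[of _ _ id]) (auto simp: inv)
  ultimately show ?thesis using grp by (simp add: topological_group_def)
qed

lemma metrizable_sub_top: "metrizable_space (sub_top G)"
  using completely_metrizable_imp_metrizable_space[OF completely_metrizable_cantor]
  by (rule metrizable_space_subtopology)

text \<open>A cylinder containing \<open>x\<close> and \<open>y\<close> is invariant under translation by \<open>x + y\<close>, so
  translating inside it and fixing everything outside is a homeomorphism.\<close>

lemma strongly_locally_homogeneous_sub_top:
  assumes "cantor_subgroup G"
  shows "strongly_locally_homogeneous (sub_top G)"
  unfolding strongly_locally_homogeneous_def
proof (rule exI, intro conjI ballI)
  let ?B = "range (\<lambda>(c, n). G \<inter> cyl c n)"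
  show "base_of (sub_top G) ?B"
    unfolding base_of_def
  proof (intro conjI ballI allI impI)
    fix W x assume "openin (sub_top G) W \<and> x \<in> W"
    then obtain n where "x \<in> G \<inter> cyl x n" "G \<inter> cyl x n \<subseteq> W" unfolding openin_sub_top
      using cyl_self by blast
    moreover have "G \<inter> cyl x n \<in> ?B" by auto
    ultimately show "\<exists>U\<in>?B. x \<in> U \<and> U \<subseteq> W"
      by (intro bexI[of _ "G \<inter> cyl x n"] conjI)
  qed (auto simp: openin_sub_top_cyl)
  fix U x y assume "U \<in> ?B" "x \<in> U" "y \<in> U"
  then obtain c n where U: "U = G \<inter> cyl c n" and x: "x \<in> G" "x \<in> cyl c n"
    and y: "y \<in> G" "y \<in> cyl c n" by auto
  define h where "h z = (if z \<in> cyl c n then z \<boxplus> (x \<boxplus> y) else z)" for z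
  have "z \<boxplus> (x \<boxplus> y) \<in> cyl c n \<longleftrightarrow> z \<in> cyl c n" for z
    using x y by (auto simp: cyl_def padd_def)
  then have hh: "h (h z) = z" for z by (simp add: h_def)
  have hG: "h ` G \<subseteq> G" using x y assms by (auto simp: h_def cantor_subgroup_def)
  \<comment> \<open>Points agreeing up to \<open>n\<close> lie on the same side of the cylinder, so
    \<open>h\<close> adds the same element to both.\<close>
  have "h u \<in> cyl (h z) k" if "u \<in> cyl z (max n k)" for z u k
  proof -
    have "u \<in> cyl c n \<longleftrightarrow> z \<in> cyl c n" using that by (auto simp: cyl_def)
    then show ?thesis using that by (auto simp: h_def cyl_def padd_def)
  qed
  then have "cyl_cont G h" unfolding cyl_cont_def by blast
  then have "homeomorphic_maps (sub_top G) (sub_top G) h h"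
    using hG hh by (simp add: homeomorphic_maps_def continuous_map_sub_top)
  then have "homeomorphic_map (sub_top G) (sub_top G) h"
    using homeomorphic_maps_imp_map by blast
  moreover have "h x = y" using x by (simp add: h_def)
  moreover have "\<forall>z\<in>topspace (sub_top G) - U. h z = z" by (simp add: U h_def)
  ultimately show "\<exists>h. homeomorphic_map (sub_top G) (sub_top G) h \<and> h x = y \<and>
      (\<forall>z\<in>topspace (sub_top G) - U. h z = z)" by blast
qed

subsection \<open>Extending maps from the finite sequences\<close>

definition fin_seqs :: "point set" where
  "fin_seqs = {x. finite {i. x i}}"

definition unit_seq :: "nat \<Rightarrow> point" where
  "unit_seq n = (\<lambda>i. i = n)"

lemma fin_seqs_padd: "x \<in> fin_seqs \<Longrightarrow> y \<in> fin_seqs \<Longrightarrow> x \<boxplus> y \<in> fin_seqs"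
  unfolding fin_seqs_def padd_def
  by (auto intro: finite_subset[of _ "{i. x i} \<union> {i. y i}"])

lemma unit_seq_fin [simp]: "unit_seq n \<in> fin_seqs"
  by (simp add: fin_seqs_def unit_seq_def)

lemma padd_unit_seq_cyl: "x \<boxplus> unit_seq n \<in> cyl x n"
  by (auto simp: cyl_def padd_def unit_seq_def)

lemma padd_unit_seq_neq: "x \<boxplus> unit_seq n \<noteq> x"
proof
  assume "x \<boxplus> unit_seq n = x"
  from fun_cong[OF this, of n] show False by (simp add: padd_def unit_seq_def)
qed

lemma fin_seqs_dense: "\<exists>d. d \<in> fin_seqs \<inter> cyl x n"
proof -
  have "(\<lambda>i. i < n \<and> x i) \<in> fin_seqs \<inter> cyl x n"
    by (auto simp: fin_seqs_def cyl_def)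
  then show ?thesis by blast
qed

lemma countable_fin_seqs: "countable fin_seqs"
proof -
  have "fin_seqs \<subseteq> (\<lambda>S i. i \<in> S) ` Collect finite"
  proof
    fix x assume "x \<in> fin_seqs"
    then have "x = (\<lambda>i. i \<in> {i. x i})" "finite {i. x i}" by (auto simp: fin_seqs_def)
    then show "x \<in> (\<lambda>S i. i \<in> S) ` Collect finite" by blast
  qed
  then show ?thesis using countable_Collect_finite countable_image countable_subset by metis
qed

lemma infinite_fin_seqs: "infinite fin_seqs"
proof -
  have "inj unit_seq" by (auto simp: inj_def unit_seq_def fun_eq_iff)
  moreover have "range unit_seq \<subseteq> fin_seqs" by auto
  ultimately show ?thesis using finite_subset range_inj_infinite by metis
qed

lemma card_fin_seqs: "|fin_seqs| <o |UNIV :: point set|"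
proof -
  have "|fin_seqs| \<le>o |UNIV :: nat set|"
    by (rule card_of_ordLeqI[of "to_nat_on fin_seqs"]) (simp_all add: countable_fin_seqs inj_on_to_nat_on)
  also have "|UNIV :: nat set| <o |UNIV :: nat set set|"
    using card_of_Pow[of "UNIV :: nat set"] by simp
  also have "|UNIV :: nat set set| \<le>o |UNIV :: point set|"
    by (rule card_of_ordLeqI[of "\<lambda>S i. i \<in> S"]) (auto simp: inj_on_def fun_eq_iff)
  finally show ?thesis .
qed

definition ext_dom :: "(point \<Rightarrow> point) \<Rightarrow> nat \<Rightarrow> point set" where
  "ext_dom f n = {x. \<exists>m. \<forall>d \<in> fin_seqs \<inter> cyl x m. \<forall>d' \<in> fin_seqs \<inter> cyl x m. f d \<in> cyl (f d') n}"

text \<open>\<open>\<Inter>n. ext_dom f n\<close> is the set where the oscillation of \<open>f\<close> on \<open>fin_seqs\<close> vanishes; only there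
  is \<open>extension f\<close> meaningful.\<close>

definition extension :: "(point \<Rightarrow> point) \<Rightarrow> point \<Rightarrow> point" where
  "extension f x = (\<lambda>i. \<exists>m. \<forall>d \<in> fin_seqs \<inter> cyl x m. f d i)"

lemma cyl_open_ext_dom: "cyl_open (ext_dom f n)"
  unfolding cyl_open_def
proof
  fix x assume "x \<in> ext_dom f n"
  then obtain m where m: "\<forall>d \<in> fin_seqs \<inter> cyl x m. \<forall>d' \<in> fin_seqs \<inter> cyl x m. f d \<in> cyl (f d') n"
    by (auto simp: ext_dom_def)
  have "y \<in> ext_dom f n" if "y \<in> cyl x m" for y
    unfolding ext_dom_def by (intro CollectI exI[of _ m]) (unfold cyl_cong[OF that], rule m)
  then show "\<exists>m. cyl x m \<subseteq> ext_dom f n" by blast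
qed

text \<open>Where the first \<open>n\<close> coordinates of \<open>f\<close> have settled, they
  agree with their eventual values, because \<open>fin_seqs\<close> meets every smaller
  cylinder.\<close>

lemma extension_approx:
  assumes "x \<in> ext_dom f n"
  obtains m where "\<And>d. d \<in> fin_seqs \<inter> cyl x m \<Longrightarrow> f d \<in> cyl (extension f x) n"
proof -
  obtain m where m: "\<And>d d'. d \<in> fin_seqs \<inter> cyl x m \<Longrightarrow> d' \<in> fin_seqs \<inter> cyl x m \<Longrightarrow> f d \<in> cyl (f d') n"
    using assms unfolding ext_dom_def by blast
  have "f d i = extension f x i" if d: "d \<in> fin_seqs \<inter> cyl x m" and i: "i < n" for d i
  proof
    assume di: "f d i"
    have "f d' i" if "d' \<in> fin_seqs \<inter> cyl x m" for d'
      using m[OF that d] i di by (simp add: cyl_def)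
    then show "extension f x i" unfolding extension_def by blast
  next
    assume "extension f x i"
    then obtain m' where m': "\<And>d. d \<in> fin_seqs \<inter> cyl x m' \<Longrightarrow> f d i"
      unfolding extension_def by blast
    obtain d' where "d' \<in> fin_seqs \<inter> cyl x (max m m')" using fin_seqs_dense by blast
    then have d': "d' \<in> fin_seqs \<inter> cyl x m" "d' \<in> fin_seqs \<inter> cyl x m'"
      using cyl_mono[of m "max m m'"] cyl_mono[of m' "max m m'"] by auto
    show "f d i" using m[OF d d'(1)] m'[OF d'(2)] i by (simp add: cyl_def)
  qed
  then have "f d \<in> cyl (extension f x) n" if "d \<in> fin_seqs \<inter> cyl x m" for d
    using that by (simp add: cyl_def)
  then show thesis using that by blast
qed

text \<open>The values at \<open>x\<close> and \<open>y\<close> are compared through a finite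
  sequence \<open>d\<close> close to \<open>y\<close> and still inside the cylinder of
  \<open>x\<close>.\<close>

lemma cyl_cont_extension: "cyl_cont (\<Inter>n. ext_dom f n) (extension f)"
  unfolding cyl_cont_def
proof (intro ballI allI)
  fix x n assume "x \<in> (\<Inter>n. ext_dom f n)"
  then obtain m where m: "\<And>d. d \<in> fin_seqs \<inter> cyl x m \<Longrightarrow> f d \<in> cyl (extension f x) n"
    using extension_approx[of x f n] by blast
  have "extension f y \<in> cyl (extension f x) n" if y: "y \<in> (\<Inter>n. ext_dom f n) \<inter> cyl x m" for y
  proof -
    obtain m' where m': "\<And>d. d \<in> fin_seqs \<inter> cyl y m' \<Longrightarrow> f d \<in> cyl (extension f y) n"
      using extension_approx[of y f n] y by blast
    obtain d where d: "d \<in> fin_seqs \<inter> cyl y (max m m')" using fin_seqs_dense by blast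
    then have "d \<in> fin_seqs \<inter> cyl y m'" "d \<in> fin_seqs \<inter> cyl x m"
      using cyl_mono[of m' "max m m'" y] cyl_sub[of y x m "max m m'"] y by auto
    then show ?thesis using m[of d] m'[of d] by (simp add: cyl_def)
  qed
  then show "\<exists>m. \<forall>y \<in> (\<Inter>n. ext_dom f n) \<inter> cyl x m. extension f y \<in> cyl (extension f x) n" by blast
qed

text \<open>Continuity of \<open>\<phi>\<close> makes the oscillation of \<open>f\<close> vanish on
  \<open>G\<close>, and both values are limits along \<open>fin_seqs\<close>.\<close>

lemma extension_eq:
  assumes G: "fin_seqs \<subseteq> G" and \<phi>: "cyl_cont G \<phi>" and f: "\<And>d. d \<in> fin_seqs \<Longrightarrow> f d = \<phi> d"
    and x: "x \<in> G"
  shows "x \<in> (\<Inter>n. ext_dom f n)" "extension f x = \<phi> x"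
proof -
  have near: "\<exists>m. \<forall>d \<in> fin_seqs \<inter> cyl x m. f d \<in> cyl (\<phi> x) n" for n
    using \<phi> x f G unfolding cyl_cont_def by (metis (no_types, lifting) IntD1 IntD2 IntI subsetD)
  show dom: "x \<in> (\<Inter>n. ext_dom f n)"
  proof
    fix n
    obtain m where "\<forall>d \<in> fin_seqs \<inter> cyl x m. f d \<in> cyl (\<phi> x) n" using near by blast
    then have "\<forall>d \<in> fin_seqs \<inter> cyl x m. \<forall>d' \<in> fin_seqs \<inter> cyl x m. f d \<in> cyl (f d') n"
      using cyl_cong by blast
    then show "x \<in> ext_dom f n" unfolding ext_dom_def by blast
  qed
  show "extension f x = \<phi> x"
  proof
    fix i
    obtain m where m: "\<And>d. d \<in> fin_seqs \<inter> cyl x m \<Longrightarrow> f d \<in> cyl (extension f x) (Suc i)"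
      using extension_approx[of x f "Suc i"] dom by blast
    obtain m' where m': "\<forall>d \<in> fin_seqs \<inter> cyl x m'. f d \<in> cyl (\<phi> x) (Suc i)" using near by blast
    obtain d where "d \<in> fin_seqs \<inter> cyl x (max m m')" using fin_seqs_dense by blast
    then have "d \<in> fin_seqs \<inter> cyl x m" "d \<in> fin_seqs \<inter> cyl x m'"
      using cyl_mono[of m "max m m'"] cyl_mono[of m' "max m m'"] by auto
    then have "f d \<in> cyl (extension f x) (Suc i)" "f d \<in> cyl (\<phi> x) (Suc i)" using m m' by blast+
    then show "extension f x i = \<phi> x i" by (simp add: cyl_def)
  qed
qed

text \<open>Near \<open>x\<close> there are two finite sequences with different values, and at least
  one of these differs from \<open>k x\<close>.\<close>

lemma nowhere_const_superset:
  assumes "nowhere_const fin_seqs k" "fin_seqs \<subseteq> A"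
  shows "nowhere_const A k"
  unfolding nowhere_const_def
proof (intro ballI allI)
  fix x n
  obtain d where d: "d \<in> fin_seqs \<inter> cyl x n" using fin_seqs_dense by blast
  then obtain y where y: "y \<in> fin_seqs \<inter> cyl d n" "k y \<noteq> k d"
    using assms(1) unfolding nowhere_const_def by blast
  then have "y \<in> A \<inter> cyl x n" "d \<in> A \<inter> cyl x n" using d cyl_cong assms(2) by blast+
  then show "\<exists>y \<in> A \<inter> cyl x n. k y \<noteq> k x" using y by metis
qed

lemma nowhere_const_cong:
  "(\<And>x. x \<in> A \<Longrightarrow> k x = l x) \<Longrightarrow> nowhere_const A k \<longleftrightarrow> nowhere_const A l"
  unfolding nowhere_const_def by (metis IntD1)

subsection \<open>The group\<close>

text \<open>Sequences of open sets and maps on \<open>fin_seqs\<close> are coded by points, so that points can index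
  the requirements met by the construction.\<close>

definition decode_opens :: "point \<Rightarrow> nat \<Rightarrow> point set" where
  "decode_opens p n = {x. \<exists>m. p (prod_encode (n, to_nat (map x [0..<m])))}"

definition decode_map :: "point \<Rightarrow> point \<Rightarrow> point" where
  "decode_map p d = (\<lambda>i. p (prod_encode (to_nat_on fin_seqs d, i)))"

text \<open>The code marks every cylinder contained in \<open>U n\<close>; by openness the marked
  cylinders cover \<open>U n\<close>.\<close>

lemma decode_opens_surj:
  assumes "\<And>n. cyl_open (U n)"
  obtains p where "decode_opens p = U"
proof -
  define p where "p k = (case prod_decode k of (n, c) \<Rightarrow>
     {y. map y [0..<length (from_nat c :: bool list)] = from_nat c} \<subseteq> U n)" for k
  have p: "p (prod_encode (n, to_nat (map x [0..<m]))) \<longleftrightarrow> cyl x m \<subseteq> U n" for n m x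
  proof -
    have "{y. map y [0..<m] = map x [0..<m]} = cyl x m" by (auto simp: cyl_def)
    then show ?thesis by (simp add: p_def)
  qed
  have "decode_opens p n = U n" for n
  proof -
    have "x \<in> decode_opens p n \<longleftrightarrow> x \<in> U n" for x
      unfolding decode_opens_def p mem_Collect_eq
      using assms[of n] cyl_self unfolding cyl_open_def by blast
    then show ?thesis by blast
  qed
  then show thesis using that by blast
qed

lemma decode_map_surj:
  obtains p where "\<And>d. d \<in> fin_seqs \<Longrightarrow> decode_map p d = f d"
proof -
  define p where "p k = (case prod_decode k of (n, i) \<Rightarrow> f (from_nat_into fin_seqs n) i)" for k
  have "decode_map p d = f d" if "d \<in> fin_seqs" for d
    using that countable_fin_seqs by (simp add: decode_map_def p_def)
  then show thesis using that by blast
qed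

text \<open>A fixed continuous map that is injective, as is its sum with the identity. With it the
  escaping theorem also serves requirements that merely ask for a point of a given set.\<close>

definition right_shift :: "point \<Rightarrow> point" where
  "right_shift x = case_nat False x"

lemma right_shift_simps [simp]: "right_shift x 0 = False" "right_shift x (Suc i) = x i"
  by (simp_all add: right_shift_def)

lemma cyl_cont_right_shift: "cyl_cont A right_shift"
  unfolding cyl_cont_def
proof (intro ballI allI)
  fix x n
  have "right_shift y \<in> cyl (right_shift x) n" if "y \<in> cyl x n" for y
    unfolding cyl_def
  proof (intro CollectI allI impI)
    fix i assume "i < n"
    then show "right_shift y i = right_shift x i" using that by (cases i) (auto simp: cyl_def)
  qed
  then show "\<exists>m. \<forall>y \<in> A \<inter> cyl x m. right_shift y \<in> cyl (right_shift x) n" by blast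
qed

lemma inj_right_shift: "inj right_shift"
proof (rule injI)
  fix x y assume "right_shift x = right_shift y"
  then have "right_shift x (Suc i) = right_shift y (Suc i)" for i by simp
  then show "x = y" by auto
qed

text \<open>Coordinate 0 of the sum is \<open>x 0\<close>, and coordinate \<open>Suc i\<close>
  determines \<open>x (Suc i)\<close> once \<open>x i\<close> is known.\<close>

lemma inj_padd_right_shift: "inj (\<lambda>x. x \<boxplus> right_shift x)"
proof (rule injI)
  fix x y assume *: "x \<boxplus> right_shift x = y \<boxplus> right_shift y"
  have eq: "(x i \<noteq> right_shift x i) = (y i \<noteq> right_shift y i)" for i
    using fun_cong[OF *, of i] by (simp add: padd_def)
  have "x i = y i" for i
  proof (induction i)
    case 0
    show ?case using eq[of 0] by simp
  next
    case (Suc i)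
    then show ?case using eq[of "Suc i"] by simp blast
  qed
  then show "x = y" by blast
qed

lemma inj_nowhere_const:
  assumes "inj k" "\<And>x n. x \<in> A \<Longrightarrow> \<exists>y \<in> A \<inter> cyl x n. y \<noteq> x"
  shows "nowhere_const A k"
  using assms unfolding nowhere_const_def by (metis injD)

text \<open>The first bit of an index selects the kind of requirement: \<open>True\<close> to meet a
  coded intersection of open sets, \<open>False\<close> to defeat a coded map. The remaining bits
  are the code.\<close>

theorem exists_diagonal_group:
  obtains G where "cantor_subgroup G" "fin_seqs \<subseteq> G"
    "\<And>U A. (\<And>n. cyl_open (U n)) \<Longrightarrow> A = (\<Inter>n :: nat. U n) \<Longrightarrow> A \<noteq> {} \<Longrightarrow>
       (\<And>x n. x \<in> A \<Longrightarrow> \<exists>y \<in> A \<inter> cyl x n. y \<noteq> x) \<Longrightarrow> G \<inter> A \<noteq> {}"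
    "\<And>\<phi>. \<phi> ` G \<subseteq> G \<Longrightarrow> cyl_cont G \<phi> \<Longrightarrow> nowhere_const fin_seqs \<phi> \<Longrightarrow>
       nowhere_const fin_seqs (\<lambda>x. x \<boxplus> \<phi> x) \<Longrightarrow> False"
proof -
  define A where "A p = (let q = p \<circ> Suc in
     \<Inter>n. if p 0 then decode_opens q n else ext_dom (decode_map q) n)" for p :: point
  define k where "k p = (let q = p \<circ> Suc in
     if p 0 then right_shift else extension (decode_map q))" for p :: point
  obtain X where X: "fin_seqs \<subseteq> X" and esc:
    "\<And>p P. P \<subseteq> A p \<Longrightarrow> |UNIV :: point set| \<le>o |P| \<Longrightarrow> inj_on (k p) P \<Longrightarrow>
        inj_on (\<lambda>x. x \<boxplus> k p x) P \<Longrightarrow> \<exists>x \<in> gen X \<inter> A p. k p x \<notin> gen X"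
    using exists_group_escaping[OF infinite_fin_seqs card_fin_seqs, of A k] by blast
  show thesis
  proof (rule that)
    show "cantor_subgroup (gen X)" by (simp add: cantor_subgroup_def gen.zero gen_add)
    show fin: "fin_seqs \<subseteq> gen X" using X gen_base by blast
    fix \<phi> assume \<phi>: "\<phi> ` gen X \<subseteq> gen X" "cyl_cont (gen X) \<phi>" "nowhere_const fin_seqs \<phi>"
      "nowhere_const fin_seqs (\<lambda>x. x \<boxplus> \<phi> x)"
    obtain q where q: "\<And>d. d \<in> fin_seqs \<Longrightarrow> decode_map q d = \<phi> d"
      using decode_map_surj[of \<phi>] by blast
    define p where "p = case_nat False q"
    let ?f = "decode_map q"
    have "p \<circ> Suc = q" "\<not> p 0" by (auto simp: p_def)
    then have p: "A p = (\<Inter>n. ext_dom ?f n)" "k p = extension ?f" by (simp_all add: A_def k_def)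
    \<comment> \<open>On the group the extension is \<open>\<phi>\<close> itself, so a group element
      whose image escapes contradicts the invariance of the group.\<close>
    have eq: "extension ?f x = \<phi> x" "x \<in> A p" if "x \<in> gen X" for x
      using extension_eq[OF fin \<phi>(2) q that] by (auto simp: p)
    have sub: "fin_seqs \<subseteq> A p" using eq fin by blast
    have "nowhere_const fin_seqs (extension ?f)"
      "nowhere_const fin_seqs (\<lambda>x. x \<boxplus> extension ?f x)"
      using \<phi>(3,4) eq(1) fin
        nowhere_const_cong[of fin_seqs "extension ?f" \<phi>]
        nowhere_const_cong[of fin_seqs "\<lambda>x. x \<boxplus> extension ?f x" "\<lambda>x. x \<boxplus> \<phi> x"]
      by (simp_all add: subset_iff)
    then have nc: "nowhere_const (A p) (extension ?f)"
      "nowhere_const (A p) (\<lambda>x. x \<boxplus> extension ?f x)"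
      using nowhere_const_superset[OF _ sub] by blast+
    have ne: "A p \<noteq> {}" using sub unit_seq_fin by blast
    have "cyl_cont (A p) (extension ?f)" unfolding p(1) by (rule cyl_cont_extension)
    then obtain P where "P \<subseteq> A p" "|UNIV :: point set| \<le>o |P|" "inj_on (extension ?f) P"
      "inj_on (\<lambda>x. x \<boxplus> extension ?f x) P"
      by (rule perfect_subset[OF cyl_open_ext_dom p(1) ne _ nc])
    then have "\<exists>x \<in> gen X \<inter> A p. extension ?f x \<notin> gen X" using esc[of P p] unfolding p(2) by blast
    then obtain x where x: "x \<in> gen X" "extension ?f x \<notin> gen X" by blast
    then show False using eq(1)[OF x(1)] \<phi>(1) by (simp add: image_subset_iff)
  next
    fix U B
    assume U: "\<And>n. cyl_open (U n)" and B: "B = (\<Inter>n :: nat. U n)" "B \<noteq> {}"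
      "\<And>x n. x \<in> B \<Longrightarrow> \<exists>y \<in> B \<inter> cyl x n. y \<noteq> x"
    obtain q where q: "decode_opens q = U" by (rule decode_opens_surj[OF U])
    define p where "p = case_nat True q"
    have "p \<circ> Suc = q" "p 0" by (auto simp: p_def)
    then have p: "A p = B" "k p = right_shift" by (simp_all add: A_def k_def q B)
    have nc: "nowhere_const B right_shift" "nowhere_const B (\<lambda>x. x \<boxplus> right_shift x)"
      using B(3) inj_right_shift inj_padd_right_shift by (auto intro: inj_nowhere_const)
    obtain P where "P \<subseteq> B" "|UNIV :: point set| \<le>o |P|" "inj_on right_shift P"
      "inj_on (\<lambda>x. x \<boxplus> right_shift x) P"
      by (rule perfect_subset[OF U B(1,2) cyl_cont_right_shift nc])
    then show "gen X \<inter> B \<noteq> {}" using esc[of P p] p by auto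
  qed
qed

text \<open>Dense open sets of \<open>G\<close> are traces of dense open sets of the Cantor group.
  Inside a cylinder the latter intersect in a nonempty set without isolated points, which
  \<open>G\<close> must meet.\<close>

lemma Baire_sub_top:
  assumes G: "fin_seqs \<subseteq> G"
    and meets: "\<And>U A. (\<And>n. cyl_open (U n)) \<Longrightarrow> A = (\<Inter>n :: nat. U n) \<Longrightarrow> A \<noteq> {} \<Longrightarrow>
       (\<And>x n. x \<in> A \<Longrightarrow> \<exists>y \<in> A \<inter> cyl x n. y \<noteq> x) \<Longrightarrow> G \<inter> A \<noteq> {}"
  shows "Baire_space (sub_top G)"
  unfolding Baire_space_def
proof (intro allI impI)
  fix \<U> assume \<U>: "countable \<U> \<and> (\<forall>U\<in>\<U>. openin (sub_top G) U \<and> dense_in (sub_top G) U)"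
  have "\<exists>V. cyl_open V \<and> U = V \<inter> G" if "U \<in> \<U>" for U
    using \<U> that by (auto simp: openin_subtopology openin_cantor)
  then obtain V where V: "\<And>U. U \<in> \<U> \<Longrightarrow> cyl_open (V U)" "\<And>U. U \<in> \<U> \<Longrightarrow> U = V U \<inter> G" by metis
  have V_dense: "V U \<inter> cyl x n \<noteq> {}" if "U \<in> \<U>" for U x n
  proof -
    obtain d where "d \<in> fin_seqs \<inter> cyl x n" using fin_seqs_dense by blast
    then have "d \<in> G" "cyl d n = cyl x n" using G cyl_cong by blast+
    moreover have "U \<inter> cyl d n \<noteq> {}" using \<U> that \<open>d \<in> G\<close> by (auto simp: dense_in_sub_top)
    ultimately show ?thesis using V(2)[OF that] by auto
  qed
  have "G \<inter> \<Inter>\<U> \<inter> cyl x r \<noteq> {}" for x r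
  proof -
    \<comment> \<open>Inserting \<open>UNIV\<close> keeps the family nonempty, so that
      \<open>from_nat_into\<close> enumerates it.\<close>
    define \<V> where "\<V> = insert UNIV (V ` \<U>)"
    have \<V>: "countable \<V>" "\<V> \<noteq> {}" using \<U> by (auto simp: \<V>_def)
    have \<V>_open: "cyl_open W" if "W \<in> \<V>" for W
      using that V by (auto simp: \<V>_def) (simp add: cyl_open_def)
    have \<V>_dense: "W \<inter> cyl y n \<noteq> {}" if "W \<in> \<V>" for W y n
      using that V_dense by (auto simp: \<V>_def)
    define U where "U n = from_nat_into \<V> n \<inter> cyl x r" for n
    define A where "A = (\<Inter>n. U n)"
    have A: "y \<in> A \<longleftrightarrow> y \<in> cyl x r \<and> (\<forall>W\<in>\<V>. y \<in> W)" for y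
      using range_from_nat_into[OF \<V>(2,1)] unfolding A_def U_def by blast
    have "G \<inter> A \<noteq> {}"
    proof (rule meets)
      show "cyl_open (U n)" for n
        unfolding U_def using \<V>_open \<V>(2) by (intro cyl_open_Int cyl_open_cyl) (simp add: from_nat_into)
      show "A \<noteq> {}" using cantor_Baire[OF \<V>(1) \<V>_open \<V>_dense, of x r] A by blast
      fix a n assume a: "a \<in> A"
      \<comment> \<open>That \<open>a\<close> is not isolated follows by category with the
        complement of \<open>a\<close> as one more dense open set.\<close>
      have "\<exists>y \<in> cyl a (max n r). \<forall>W \<in> insert (- {a}) \<V>. y \<in> W"
      proof (rule cantor_Baire)
        fix W assume W: "W \<in> insert (- {a}) \<V>"
        show "cyl_open W"
        proof (cases "W \<in> \<V>")
          case False
          then have "W = - {a}" using W by simp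
          moreover have "\<exists>m. cyl y m \<subseteq> - {a}" if "y \<noteq> a" for y
            using neq_imp_cyl_disjoint[OF that] cyl_self[of a] by blast
          ultimately show ?thesis by (auto simp: cyl_open_def)
        qed (rule \<V>_open)
        fix y m
        show "W \<inter> cyl y m \<noteq> {}"
        proof (cases "W \<in> \<V>")
          case False
          then have "W = - {a}" using W by simp
          then show ?thesis
            using cyl_self[of y m] padd_unit_seq_cyl[of y m] padd_unit_seq_neq[of y m]
            by (cases "y = a") auto
        qed (rule \<V>_dense)
      qed (use \<V> in simp)
      then obtain y where y: "y \<in> cyl a (max n r)" "y \<noteq> a" "\<And>W. W \<in> \<V> \<Longrightarrow> y \<in> W" by auto
      have "a \<in> cyl x r" using a A by blast
      then have "y \<in> cyl a n" "y \<in> cyl x r"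
        using y cyl_mono[of n "max n r" a] cyl_sub[of a x r "max n r"] by auto
      then show "\<exists>y \<in> A \<inter> cyl a n. y \<noteq> a" using A y by blast
    qed (rule A_def)
    moreover have "y \<in> U" if "y \<in> G" "y \<in> A" "U \<in> \<U>" for y U
      using that V(2)[OF that(3)] by (auto simp: A \<V>_def)
    moreover have "A \<subseteq> cyl x r" using A by blast
    ultimately show ?thesis by fast
  qed
  then show "dense_in (sub_top G) (topspace (sub_top G) \<inter> \<Inter>\<U>)"
    by (simp add: dense_in_sub_top)
qed

section \<open>A countable dense set without four distinct members of sum zero\<close>

text \<open>The last nonzero entry of \<open>marked_seq m\<close> is at position \<open>m\<close>. Each member of \<open>fin_seqs\<close>
  is enumerated for infinitely many \<open>m\<close>, whence density.\<close>

definition marked_seq :: "nat \<Rightarrow> point" where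
  "marked_seq m = (\<lambda>i. i = m \<or> i < m \<and> from_nat_into fin_seqs (fst (prod_decode m)) i)"

lemma marked_seq_at: "p \<le> M \<Longrightarrow> marked_seq p M \<longleftrightarrow> p = M"
  by (auto simp: marked_seq_def)

lemma marked_seq_fin: "marked_seq m \<in> fin_seqs"
  unfolding fin_seqs_def marked_seq_def
  by (auto intro: finite_subset[of _ "{..m}"])

lemma marked_seq_dense: "\<exists>d. d \<in> range marked_seq \<inter> cyl x n"
proof -
  obtain d where d: "d \<in> fin_seqs \<inter> cyl x n" using fin_seqs_dense by blast
  define m where "m = prod_encode (to_nat_on fin_seqs d, n)"
  \<comment> \<open>Encoding \<open>n\<close> along with \<open>d\<close> pushes the marker at
    \<open>m\<close> past the coordinates that must agree with \<open>x\<close>.\<close>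
  have "n \<le> m" unfolding m_def by (rule le_prod_encode_2)
  have "from_nat_into fin_seqs (fst (prod_decode m)) = d"
    using d countable_fin_seqs by (simp add: m_def)
  then have "marked_seq m \<in> cyl x n"
    using d \<open>n \<le> m\<close> by (auto simp: marked_seq_def cyl_def)
  then show ?thesis by blast
qed

text \<open>At the largest of the four indices exactly one of the sequences is \<open>True\<close>,
  so the two sums differ there.\<close>

lemma marked_seq_Sidon:
  assumes "marked_seq p \<boxplus> marked_seq q = marked_seq r \<boxplus> marked_seq s"
    and "p \<noteq> q" "p \<noteq> r" "p \<noteq> s" "q \<noteq> r" "q \<noteq> s" "r \<noteq> s"
  shows False
proof -
  define M where "M = Max {p, q, r, s}"
  have "M \<in> {p, q, r, s}" unfolding M_def by (rule Max_in) auto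
  moreover have "p \<le> M" "q \<le> M" "r \<le> M" "s \<le> M" by (auto simp: M_def)
  moreover have "(marked_seq p M \<noteq> marked_seq q M) = (marked_seq r M \<noteq> marked_seq s M)"
    using fun_cong[OF assms(1), of M] by (simp add: padd_def)
  ultimately show False using assms(2-) by (auto simp: marked_seq_at)
qed

text \<open>If \<open>x + \<phi> x\<close> were constant on a cylinder, \<open>\<phi>\<close> would be a translation there and map
  \<open>d\<close>, \<open>d + u\<close>, \<open>d + v\<close>, \<open>d + u + v\<close> to four distinct points with sum zero.\<close>

lemma nowhere_const_into_marked:
  assumes inj: "inj_on \<phi> fin_seqs" and im: "\<phi> ` fin_seqs \<subseteq> range marked_seq"
  shows "nowhere_const fin_seqs (\<lambda>x. x \<boxplus> \<phi> x)"
proof (rule ccontr)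
  assume "\<not> ?thesis"
  then obtain d n where d: "d \<in> fin_seqs" and
    const: "\<And>y. y \<in> fin_seqs \<Longrightarrow> y \<in> cyl d n \<Longrightarrow> y \<boxplus> \<phi> y = d \<boxplus> \<phi> d"
    unfolding nowhere_const_def by blast
  \<comment> \<open>Units at positions \<open>n\<close> and \<open>Suc n\<close> leave the first
    \<open>n\<close> coordinates alone, so all translates of \<open>d\<close> stay in the
    cylinder.\<close>
  define u v where "u = unit_seq n" and "v = unit_seq (Suc n)"
  have "u n" "v (Suc n)" "\<not> u (Suc n)" by (simp_all add: u_def v_def unit_seq_def)
  then have uv: "u \<noteq> \<zero>\<^sub>p" "v \<noteq> \<zero>\<^sub>p" "u \<noteq> v" by metis+
  have fin: "d \<boxplus> u \<in> fin_seqs" "d \<boxplus> v \<in> fin_seqs" "d \<boxplus> (u \<boxplus> v) \<in> fin_seqs"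
    using d by (auto intro!: fin_seqs_padd simp: u_def v_def)
  have cyl: "d \<boxplus> u \<in> cyl d n" "d \<boxplus> v \<in> cyl d n" "d \<boxplus> (u \<boxplus> v) \<in> cyl d n"
    by (auto simp: cyl_def padd_def u_def v_def unit_seq_def)
  have eqs: "\<phi> (d \<boxplus> u) = u \<boxplus> \<phi> d" "\<phi> (d \<boxplus> v) = v \<boxplus> \<phi> d"
    "\<phi> (d \<boxplus> (u \<boxplus> v)) = u \<boxplus> v \<boxplus> \<phi> d"
    by (rule padd_shift, rule const, rule fin, rule cyl)+
  have "\<exists>p. \<phi> x = marked_seq p" if "x \<in> fin_seqs" for x
    using im that by blast
  then obtain p q r s where pqrs: "\<phi> d = marked_seq p" "\<phi> (d \<boxplus> u) = marked_seq q"
    "\<phi> (d \<boxplus> v) = marked_seq r" "\<phi> (d \<boxplus> (u \<boxplus> v)) = marked_seq s"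
    using d fin by presburger
  have ne: "d \<noteq> d \<boxplus> u" "d \<noteq> d \<boxplus> v" "d \<noteq> d \<boxplus> (u \<boxplus> v)" "d \<boxplus> u \<noteq> d \<boxplus> v"
    "d \<boxplus> u \<noteq> d \<boxplus> (u \<boxplus> v)" "d \<boxplus> v \<noteq> d \<boxplus> (u \<boxplus> v)"
    using uv by (simp_all add: padd_eq_self padd_eq_zero)
  have "marked_seq p \<boxplus> marked_seq q = marked_seq r \<boxplus> marked_seq s"
    unfolding pqrs[symmetric] eqs by (simp add: padd_ac)
  moreover have "p \<noteq> q" "p \<noteq> r" "p \<noteq> s" "q \<noteq> r" "q \<noteq> s" "r \<noteq> s"
    using ne pqrs inj_on_contraD[OF inj _ d fin(1)] inj_on_contraD[OF inj _ d fin(2)]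
      inj_on_contraD[OF inj _ d fin(3)] inj_on_contraD[OF inj _ fin(1,2)]
      inj_on_contraD[OF inj _ fin(1,3)] inj_on_contraD[OF inj _ fin(2,3)]
    by fastforce+
  ultimately show False by (rule marked_seq_Sidon)
qed

section \<open>Failure of countable dense homogeneity and assembly of the properties\<close>

theorem mainTheorem2:
  shows "\<exists>(G :: point monoid) (T :: point topology).
    topological_group G T \<and> metrizable_space T \<and> separable_space T \<and> Baire_space T \<and>
    strongly_locally_homogeneous T \<and> \<not> CDH_space T"
proof -
  obtain G where G: "cantor_subgroup G" "fin_seqs \<subseteq> G" and
    meets: "\<And>U A. (\<And>n. cyl_open (U n)) \<Longrightarrow> A = (\<Inter>n :: nat. U n) \<Longrightarrow> A \<noteq> {} \<Longrightarrow>
       (\<And>x n. x \<in> A \<Longrightarrow> \<exists>y \<in> A \<inter> cyl x n. y \<noteq> x) \<Longrightarrow> G \<inter> A \<noteq> {}" and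
    diag: "\<And>\<phi>. \<phi> ` G \<subseteq> G \<Longrightarrow> cyl_cont G \<phi> \<Longrightarrow> nowhere_const fin_seqs \<phi> \<Longrightarrow>
       nowhere_const fin_seqs (\<lambda>x. x \<boxplus> \<phi> x) \<Longrightarrow> False"
    by (rule exists_diagonal_group) blast
  have dense: "dense_in (sub_top G) fin_seqs" "dense_in (sub_top G) (range marked_seq)"
    unfolding dense_in_sub_top using fin_seqs_dense marked_seq_dense marked_seq_fin G(2) by blast+
  have "\<not> CDH_space (sub_top G)"
  proof
    assume "CDH_space (sub_top G)"
    then obtain \<phi> where \<phi>: "homeomorphic_map (sub_top G) (sub_top G) \<phi>"
      and im: "\<phi> ` fin_seqs = range marked_seq"
      using dense countable_fin_seqs unfolding CDH_space_def by (meson countableI_type countable_image)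
    have cont: "\<phi> ` G \<subseteq> G" "cyl_cont G \<phi>"
      using homeomorphic_imp_continuous_map[OF \<phi>] by (auto simp: continuous_map_sub_top)
    have "inj_on \<phi> G" using homeomorphic_imp_injective_map[OF \<phi>] by simp
    then have inj: "inj_on \<phi> fin_seqs" using G(2) inj_on_subset by blast
    \<comment> \<open>Injectivity suffices, since flipping coordinate \<open>n\<close> gives another
      finite sequence in the same cylinder.\<close>
    have "nowhere_const fin_seqs \<phi>"
      unfolding nowhere_const_def
    proof (intro ballI allI)
      fix x n assume x: "x \<in> fin_seqs"
      then have y: "x \<boxplus> unit_seq n \<in> fin_seqs" by (simp add: fin_seqs_padd)
      have "\<phi> (x \<boxplus> unit_seq n) \<noteq> \<phi> x" by (rule inj_on_contraD[OF inj padd_unit_seq_neq y x])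
      then show "\<exists>y \<in> fin_seqs \<inter> cyl x n. \<phi> y \<noteq> \<phi> x" using y padd_unit_seq_cyl by blast
    qed
    then show False
      using diag[OF cont] nowhere_const_into_marked[OF inj eq_refl[OF im]] by simp
  qed
  moreover have "separable_space (sub_top G)"
    unfolding separable_space_def using dense(1) countable_fin_seqs
    by (auto simp: dense_in_def)
  moreover have "Baire_space (sub_top G)"
    by (rule Baire_sub_top[OF G(2)]) (rule meets)
  ultimately show ?thesis
    using topological_group_sub_top[OF G(1)] metrizable_sub_top[of G]
      strongly_locally_homogeneous_sub_top[OF G(1)]
    by (intro exI conjI)
qed

end
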